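(* For every integer $d\ge2$ there exists a constant $c_d>0$, depending only on $d$, such that for every $n\ge2$ of the form $n=n_1^d$ with $n_1\in\mathbb{N}$ and every $\theta_0\in\mathcal{M}^{(1)}(\mathbb{L}_{d,n})$, i.e. every constant vector $\theta_0\in\mathbb{R}^{\mathbb{L}_{d,n}}$, \[ R(\hat\theta_n,\theta_0)\ge c_d\begin{cases} n^{-1}\log^2 n&\text{if }d=2,\\ n^{-2/d}&\text{if }d\ge3.\end{cases} \]
   Context: For $n=n_1^d$, $\mathbb{L}_{d,n}:=\{1,\ldots,n_1\}^d$, partially ordered by $u\preceq v$ iff $u_j\le v_j$ for all $j$. $\mathcal{M}(\mathbb{L}_{d,n}):=\{\theta\in\mathbb{R}^{\mathbb{L}_{d,n}}:\theta_u\le\theta_v\text{ whenever }u\preceq v\}$, and $\mathcal{M}^{(1)}(\mathbb{L}_{d,n})$ is the set of constant vectors. One observes $Y=(Y_w)_{w\in\mathbb{L}_{d,n}}$ with $Y_w=(\theta_0)_w+\epsilon_w$, where the $\epsilon_w$ are independent $N(0,1)$; $\hat\theta_n$ is the Euclidean projection of $Y$ onto $\mathcal{M}(\mathbb{L}_{d,n})$ (the least squares estimator), and $R(\hat\theta_n,\theta_0):=\mathbb{E}\bigl[\frac1n\|\hat\theta_n-\theta_0\|_2^2\bigr]$. *)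

theory Defs
  imports "HOL-Probability.Probability"
begin

text \<open>
  Lattice points are extensional functions on \<open>{1..d}\<close>, and vectors indexed by the lattice are
  extensional functions on it, so that equality of points and of vectors is HOL equality.
\<close>

definition lattice_pts :: "nat \<Rightarrow> nat \<Rightarrow> (nat \<Rightarrow> nat) set" where
  "lattice_pts d n1 = {1..d} \<rightarrow>\<^sub>E {1..n1}"

definition lattice_le :: "nat \<Rightarrow> (nat \<Rightarrow> nat) \<Rightarrow> (nat \<Rightarrow> nat) \<Rightarrow> bool" where
  "lattice_le d u v \<longleftrightarrow> (\<forall>j\<in>{1..d}. u j \<le> v j)"

definition monotone_vecs :: "nat \<Rightarrow> nat \<Rightarrow> ((nat \<Rightarrow> nat) \<Rightarrow> real) set" where
  "monotone_vecs d n1 =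
     {\<theta> \<in> lattice_pts d n1 \<rightarrow>\<^sub>E UNIV.
        \<forall>u\<in>lattice_pts d n1. \<forall>v\<in>lattice_pts d n1. lattice_le d u v \<longrightarrow> \<theta> u \<le> \<theta> v}"

definition constant_vecs :: "nat \<Rightarrow> nat \<Rightarrow> ((nat \<Rightarrow> nat) \<Rightarrow> real) set" where
  "constant_vecs d n1 =
     {\<theta> \<in> lattice_pts d n1 \<rightarrow>\<^sub>E UNIV. \<exists>a. \<forall>u\<in>lattice_pts d n1. \<theta> u = a}"

definition l2_dist :: "'i set \<Rightarrow> ('i \<Rightarrow> real) \<Rightarrow> ('i \<Rightarrow> real) \<Rightarrow> real" where
  "l2_dist I x y = L2_set (\<lambda>i. x i - y i) I"

text \<open>
  The Euclidean projection onto the closed convex cone \<^const>\<open>monotone_vecs\<close>. The minimiser exists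
  and is unique, so the choice made by \<^const>\<open>arg_min_on\<close> is immaterial.
\<close>

definition lse :: "nat \<Rightarrow> nat \<Rightarrow> ((nat \<Rightarrow> nat) \<Rightarrow> real) \<Rightarrow> ((nat \<Rightarrow> nat) \<Rightarrow> real)" where
  "lse d n1 y = arg_min_on (l2_dist (lattice_pts d n1) y) (monotone_vecs d n1)"

text \<open>The joint law of independent standard normal errors \<open>(\<epsilon>\<^sub>w)\<close> indexed by the lattice.\<close>

definition noise :: "nat \<Rightarrow> nat \<Rightarrow> ((nat \<Rightarrow> nat) \<Rightarrow> real) measure" where
  "noise d n1 = PiM (lattice_pts d n1) (\<lambda>_. density lborel std_normal_density)"

definition observation ::
    "nat \<Rightarrow> nat \<Rightarrow> ((nat \<Rightarrow> nat) \<Rightarrow> real) \<Rightarrow> ((nat \<Rightarrow> nat) \<Rightarrow> real) \<Rightarrow> ((nat \<Rightarrow> nat) \<Rightarrow> real)" where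
  "observation d n1 \<theta>0 \<epsilon> = (\<lambda>w\<in>lattice_pts d n1. \<theta>0 w + \<epsilon> w)"

definition risk ::
    "nat \<Rightarrow> nat \<Rightarrow> (((nat \<Rightarrow> nat) \<Rightarrow> real) \<Rightarrow> ((nat \<Rightarrow> nat) \<Rightarrow> real)) \<Rightarrow> ((nat \<Rightarrow> nat) \<Rightarrow> real) \<Rightarrow> real" where
  "risk d n1 \<theta>hat \<theta>0 =
     (LINT \<epsilon>|noise d n1.
        1 / real (n1 ^ d) * (l2_dist (lattice_pts d n1) (\<theta>hat (observation d n1 \<theta>0 \<epsilon>)) \<theta>0)\<^sup>2)"

end

theory Submission
  imports Defs
begin

text \<open>
  Why the bound holds. Adding a constant maps the cone \<open>K\<close> of monotone vectors to itself, so at a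
  constant truth the estimation error is the projection of the noise \<open>\<epsilon>\<close> onto \<open>K\<close>. For a cone, the
  squared norm of this projection is the largest value over \<open>k \<in> K\<close> of
  \<open>2 \<langle>\<epsilon>, k\<rangle> - \<parallel>k\<parallel>\<^sup>2\<close> (lemma \<open>lse_loss_maximal_gain\<close>; this value is called the gain of \<open>k\<close>). Hence
  any rule that picks a monotone vector after looking at \<open>\<epsilon>\<close> bounds the risk from below.

  The rules used here fix a monotone vector up to a choice, on each of several disjoint blocks \<open>b\<close>
  of the lattice, between two values that differ by \<open>h b\<close>, in such a way that every combination of
  choices is monotone. Taking the higher value exactly on the blocks where the noise has a positive
  sum gives \<open>\<langle>\<epsilon>, k\<rangle>\<close> the expectation \<open>\<Sum>\<^sub>b h b \<surd>(|b| / 2\<pi>)\<close>, because a centred normal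
  variable of variance \<open>|b|\<close> has positive part of mean \<open>\<surd>(|b| / 2\<pi>)\<close>. If all these vectors have
  squared norm at most \<open>V\<close>, the best rescaling yields the bound \<open>(\<Sum>\<^sub>b h b \<surd>|b|)\<^sup>2 / (2\<pi>V)\<close>
  (lemma \<open>expectation_lse_loss_ge_blocks\<close>). It remains to choose blocks.

  \<^item> In every dimension, the points of a fixed coordinate sum form an antichain, so a vector equal to
  \<open>-1\<close> below it and \<open>1\<close> above it may take arbitrary signs on it. Some antichain of this kind has at
  least \<open>n\<^sub>1\<^sup>d / (d n\<^sub>1)\<close> points, which gives a total loss of order \<open>n\<^sub>1\<^sup>d / n\<^sub>1\<^sup>2\<close>
  (lemma \<open>expectation_lse_loss_ge_antichain\<close>).

  \<^item> In the plane this is only a constant. Instead, cut both axes at the powers of \<open>4\<close>. The rectangle of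
  index \<open>(i, j)\<close> has about \<open>4\<^sup>i\<^sup>+\<^sup>j\<close> points and carries one of the values \<open>-2 \<cdot> 2\<^sup>-\<^sup>(\<^sup>i\<^sup>+\<^sup>j\<^sup>)\<close> and
  \<open>-2\<^sup>-\<^sup>(\<^sup>i\<^sup>+\<^sup>j\<^sup>)\<close>. The higher value of one rectangle is the lower value at the next index sum, which is
  what makes all choices monotone. There are of the order of \<open>log\<^sup>2 n\<close>
  rectangles, and each contributes a constant to \<open>\<Sum>\<^sub>b h b \<surd>|b|\<close> and at most a constant to \<open>V\<close>, so
  the total loss is of the order of their number (lemma \<open>expectation_lse_loss_ge_planar\<close>).

  The risk is a Bochner integral, which is zero for a function that is not integrable, so the lower
  bound also requires integrability of the loss. Measurability comes from writing the loss as a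
  supremum of gains over countably many vectors (lemma \<open>lse_loss_eq_SUP_rational\<close>).
\<close>
section \<open>Least squares over the monotone cone\<close>

lemma finite_lattice_pts: "finite (lattice_pts d n1)"
  unfolding lattice_pts_def by (intro finite_PiE) auto

lemma card_lattice_pts: "card (lattice_pts d n1) = n1 ^ d"
  unfolding lattice_pts_def by (simp add: card_PiE)

lemma l2_dist_power2: "(l2_dist I x y)\<^sup>2 = (\<Sum>i\<in>I. (x i - y i)\<^sup>2)"
  unfolding l2_dist_def L2_set_def by (simp add: sum_nonneg)

lemma l2_dist_le_iff:
  "l2_dist I x y \<le> l2_dist I x z \<longleftrightarrow> (\<Sum>i\<in>I. (x i - y i)\<^sup>2) \<le> (\<Sum>i\<in>I. (x i - z i)\<^sup>2)"
  unfolding l2_dist_def L2_set_def by simp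

lemma restrict_in_monotone_vecs:
  assumes "\<And>u v. u \<in> lattice_pts d n1 \<Longrightarrow> v \<in> lattice_pts d n1 \<Longrightarrow> lattice_le d u v \<Longrightarrow> k u \<le> k v"
  shows "restrict k (lattice_pts d n1) \<in> monotone_vecs d n1"
  using assms by (auto simp: monotone_vecs_def)

lemma monotone_vecs_le:
  "k \<in> monotone_vecs d n1 \<Longrightarrow> u \<in> lattice_pts d n1 \<Longrightarrow> v \<in> lattice_pts d n1 \<Longrightarrow>
    lattice_le d u v \<Longrightarrow> k u \<le> k v"
  by (auto simp: monotone_vecs_def)

text \<open>
  Only vectors at least as close to \<open>y\<close> as the zero vector compete. These lie in a product of
  compact intervals and points, and the order constraints cut out a closed set in the product
  topology, so the distance attains its minimum there.
\<close>
lemma exists_closest_monotone_vec: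
  "\<exists>p\<in>monotone_vecs d n1. \<forall>k\<in>monotone_vecs d n1.
     l2_dist (lattice_pts d n1) y p \<le> l2_dist (lattice_pts d n1) y k"
proof -
  let ?I = "lattice_pts d n1" and ?K = "monotone_vecs d n1"
  let ?D = "\<lambda>k. l2_dist ?I y k"
  define z where "z = (\<lambda>w\<in>?I. 0::real)"
  have z: "z \<in> ?K" unfolding z_def by (rule restrict_in_monotone_vecs) simp
  \<comment> \<open>Off the lattice the factor is a point, which encodes extensionality and keeps the product compact.\<close>
  define S where "S w = (if w \<in> ?I then {y w - ?D z .. y w + ?D z} else {undefined})" for w
  define C where "C = {k. \<forall>u\<in>?I. \<forall>v\<in>?I. lattice_le d u v \<longrightarrow> k u \<le> (k v::real)}"
  have "compact (PiE UNIV S)"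
    using compactin_PiE[of "\<lambda>_. euclidean" UNIV S]
    by (simp add: euclidean_product_topology S_def)
  moreover have "closed C"
    unfolding C_def Ball_def
    by (intro closed_Collect_all closed_Collect_imp closed_Collect_le continuous_intros)
       (auto intro: continuous_on_product_coordinates)
  ultimately have comp: "compact (PiE UNIV S \<inter> C)" by (rule compact_Int_closed)
  have near: "k \<in> PiE UNIV S \<inter> C" if k: "k \<in> ?K" and le: "?D k \<le> ?D z" for k
  proof -
    have "\<bar>y w - k w\<bar> \<le> ?D k" if "w \<in> ?I" for w
      unfolding l2_dist_def
      using that member_le_L2_set[OF finite_lattice_pts, of w d n1 "\<lambda>i. \<bar>y i - k i\<bar>"]
      by (simp add: L2_set_def)
    then have "k w \<in> S w" for w
      using le k by (force simp: S_def monotone_vecs_def PiE_def extensional_def abs_le_iff)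
    then show ?thesis using k by (auto simp: C_def monotone_vecs_def)
  qed
  have inK: "k \<in> ?K" if "k \<in> PiE UNIV S \<inter> C" for k
  proof -
    have "k w = undefined" if "w \<notin> ?I" for w
      using \<open>k \<in> PiE UNIV S \<inter> C\<close> that by (auto simp: S_def Pi_iff split: if_splits)
    then show ?thesis using that by (auto simp: monotone_vecs_def C_def extensional_def)
  qed
  have zS: "z \<in> PiE UNIV S \<inter> C" by (intro near z) simp
  moreover have "continuous_on (PiE UNIV S \<inter> C) ?D"
    unfolding l2_dist_def L2_set_def
    by (intro continuous_intros continuous_on_subset[OF continuous_on_product_coordinates]) auto
  ultimately obtain p where p: "p \<in> PiE UNIV S \<inter> C"
      and min: "\<And>k. k \<in> PiE UNIV S \<inter> C \<Longrightarrow> ?D p \<le> ?D k"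
    using continuous_attains_inf[OF comp, of ?D] by blast
  have "?D p \<le> ?D k" if "k \<in> ?K" for k
    using min[of k] near[OF that] min[OF zS] by linarith
  then show ?thesis using inK[OF p] by blast
qed

lemma lse_closest:
  shows "lse d n1 y \<in> monotone_vecs d n1"
    and "\<And>k. k \<in> monotone_vecs d n1 \<Longrightarrow>
      l2_dist (lattice_pts d n1) y (lse d n1 y) \<le> l2_dist (lattice_pts d n1) y k"
proof -
  obtain p where p: "p \<in> monotone_vecs d n1" "\<And>k. k \<in> monotone_vecs d n1 \<Longrightarrow>
      \<not> l2_dist (lattice_pts d n1) y k < l2_dist (lattice_pts d n1) y p"
    using exists_closest_monotone_vec[of d n1 y] by (auto simp: not_less)
  have "lse d n1 y \<in> monotone_vecs d n1 \<and> (\<forall>k\<in>monotone_vecs d n1.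
      l2_dist (lattice_pts d n1) y (lse d n1 y) \<le> l2_dist (lattice_pts d n1) y k)"
    unfolding lse_def arg_min_on_def
    by (rule arg_minI[where P = "\<lambda>k. k \<in> monotone_vecs d n1"]) (use p in \<open>auto simp: not_less\<close>)
  then show "lse d n1 y \<in> monotone_vecs d n1"
    and "\<And>k. k \<in> monotone_vecs d n1 \<Longrightarrow>
      l2_dist (lattice_pts d n1) y (lse d n1 y) \<le> l2_dist (lattice_pts d n1) y k"
    by auto
qed

text \<open>
  The decrease of the squared distance to \<open>x\<close> when the approximation \<open>0\<close> is replaced by \<open>k\<close>. It is
  linear in \<open>x\<close>, which makes its expectation accessible.
\<close>
definition gain :: "'i set \<Rightarrow> ('i \<Rightarrow> real) \<Rightarrow> ('i \<Rightarrow> real) \<Rightarrow> real" where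
  "gain I x k = 2 * (\<Sum>w\<in>I. x w * k w) - (\<Sum>w\<in>I. (k w)\<^sup>2)"

lemma gain_eq: "gain I x k = (\<Sum>w\<in>I. (x w)\<^sup>2) - (\<Sum>w\<in>I. (x w - k w)\<^sup>2)"
  unfolding gain_def
  by (simp add: power2_diff sum.distrib sum_subtractf sum_distrib_left algebra_simps)

lemma gain_le: "gain I x k \<le> (\<Sum>w\<in>I. (x w)\<^sup>2)"
  unfolding gain_eq by (simp add: sum_nonneg)

lemma gain_cong: "(\<And>w. w \<in> I \<Longrightarrow> k w = l w) \<Longrightarrow> gain I x k = gain I x l"
  unfolding gain_def by simp

lemma gain_scale:
  "gain I x (\<lambda>w. t * k w) = 2 * t * (\<Sum>w\<in>I. x w * k w) - t\<^sup>2 * (\<Sum>w\<in>I. (k w)\<^sup>2)"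
  unfolding gain_def by (simp add: sum_distrib_left power_mult_distrib ac_simps)

text \<open>
  Along a ray the gain is the quadratic \<open>2 t b - t\<^sup>2 P\<close> with \<open>b = \<langle>x, q\<rangle>\<close> and \<open>P = \<parallel>q\<parallel>\<^sup>2\<close>. A maximum at
  \<open>t = 1\<close> forces \<open>b = P\<close>: the residual \<open>x - q\<close> is orthogonal to \<open>q\<close>.
\<close>
lemma sum_squares_eq_gain_of_maximal_on_ray:
  assumes max: "\<And>t. t \<ge> 0 \<Longrightarrow> gain I x (\<lambda>w. t * q w) \<le> gain I x q"
  shows "(\<Sum>w\<in>I. (q w)\<^sup>2) = gain I x q"
proof -
  define b P where "b = (\<Sum>w\<in>I. x w * q w)" and "P = (\<Sum>w\<in>I. (q w)\<^sup>2)"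
  have P0: "P \<ge> 0" unfolding P_def by (simp add: sum_nonneg)
  have quad: "2 * t * b - t\<^sup>2 * P \<le> 2 * b - P" if "t \<ge> 0" for t
    using max[OF that] unfolding gain_scale unfolding gain_def b_def P_def .
  have "b = P"
  proof (cases "P = 0")
    case True
    then show ?thesis using quad[of 0] quad[of 2] by simp
  next
    case False
    then have P: "P > 0" using P0 by simp
    then have "b / P \<ge> 0" using quad[of 0] by simp
    \<comment> \<open>\<open>t = b / P\<close> is the vertex of the quadratic.\<close>
    from quad[OF this] have "b\<^sup>2 / P \<le> 2 * b - P"
      using P by (simp add: power2_eq_square)
    then have "b\<^sup>2 \<le> (2 * b - P) * P" using P by (simp add: divide_simps)
    then have "(b - P)\<^sup>2 \<le> 0" by (simp add: power2_eq_square algebra_simps)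
    then show ?thesis by simp
  qed
  then show ?thesis unfolding gain_def b_def P_def by simp
qed

text \<open>The unnormalised squared error when the truth is the constant \<open>a\<close>, as a function of the noise.\<close>
definition lse_loss :: "nat \<Rightarrow> nat \<Rightarrow> real \<Rightarrow> ((nat \<Rightarrow> nat) \<Rightarrow> real) \<Rightarrow> real" where
  "lse_loss d n1 a \<epsilon> =
     (\<Sum>w\<in>lattice_pts d n1. (lse d n1 (\<lambda>w\<in>lattice_pts d n1. a + \<epsilon> w) w - a)\<^sup>2)"

text \<open>
  The estimator minus \<open>a\<close> is the point \<open>q\<close> of the cone closest to \<open>\<epsilon>\<close>, because the cone is invariant
  under adding constants. Being closest to \<open>\<epsilon>\<close> means having maximal gain, and as the cone is also
  invariant under scaling, this maximal gain is \<open>\<parallel>q\<parallel>\<^sup>2\<close>.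
\<close>
lemma lse_loss_maximal_gain:
  shows "k \<in> monotone_vecs d n1 \<Longrightarrow> gain (lattice_pts d n1) \<epsilon> k \<le> lse_loss d n1 a \<epsilon>"
    and "\<exists>k\<in>monotone_vecs d n1. lse_loss d n1 a \<epsilon> = gain (lattice_pts d n1) \<epsilon> k"
proof -
  let ?I = "lattice_pts d n1" and ?K = "monotone_vecs d n1"
  let ?y = "\<lambda>w\<in>?I. a + \<epsilon> w"
  define q where "q = (\<lambda>w\<in>?I. lse d n1 ?y w - a)"
  have q: "q \<in> ?K"
    unfolding q_def
    by (rule restrict_in_monotone_vecs) (use monotone_vecs_le[OF lse_closest(1)] in auto)
  have max: "gain ?I \<epsilon> k \<le> gain ?I \<epsilon> q" if k: "k \<in> ?K" for k
  proof -
    have shift: "(\<lambda>w\<in>?I. k w + a) \<in> ?K"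
      by (rule restrict_in_monotone_vecs) (use monotone_vecs_le[OF k] in auto)
    have "(\<Sum>w\<in>?I. (\<epsilon> w - q w)\<^sup>2) = (\<Sum>w\<in>?I. (?y w - lse d n1 ?y w)\<^sup>2)"
      unfolding q_def by (intro sum.cong) (auto simp: algebra_simps)
    also have "\<dots> \<le> (\<Sum>w\<in>?I. (?y w - (\<lambda>w\<in>?I. k w + a) w)\<^sup>2)"
      using lse_closest(2)[OF shift, of ?y] unfolding l2_dist_le_iff .
    also have "\<dots> = (\<Sum>w\<in>?I. (\<epsilon> w - k w)\<^sup>2)"
      by (intro sum.cong) (auto simp: algebra_simps)
    finally show ?thesis unfolding gain_eq by simp
  qed
  have ray: "gain ?I \<epsilon> (\<lambda>w. t * q w) \<le> gain ?I \<epsilon> q" if "t \<ge> 0" for t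
  proof -
    have "(\<lambda>w\<in>?I. t * q w) \<in> ?K"
      by (rule restrict_in_monotone_vecs) (use monotone_vecs_le[OF q] that in \<open>auto intro: mult_left_mono\<close>)
    from max[OF this] show ?thesis
      using gain_cong[of ?I "\<lambda>w\<in>?I. t * q w" "\<lambda>w. t * q w" \<epsilon>] by simp
  qed
  have "lse_loss d n1 a \<epsilon> = (\<Sum>w\<in>?I. (q w)\<^sup>2)"
    unfolding lse_loss_def q_def by (intro sum.cong) auto
  also have "\<dots> = gain ?I \<epsilon> q" by (rule sum_squares_eq_gain_of_maximal_on_ray[OF ray])
  finally have eq: "lse_loss d n1 a \<epsilon> = gain ?I \<epsilon> q" .
  show "k \<in> ?K \<Longrightarrow> gain ?I \<epsilon> k \<le> lse_loss d n1 a \<epsilon>" using max eq by simp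
  show "\<exists>k\<in>?K. lse_loss d n1 a \<epsilon> = gain ?I \<epsilon> k" using q eq by blast
qed

definition rational_monotone_vecs :: "nat \<Rightarrow> nat \<Rightarrow> ((nat \<Rightarrow> nat) \<Rightarrow> real) set" where
  "rational_monotone_vecs d n1 = monotone_vecs d n1 \<inter> (lattice_pts d n1 \<rightarrow>\<^sub>E \<rat>)"

lemma countable_rational_monotone_vecs: "countable (rational_monotone_vecs d n1)"
  unfolding rational_monotone_vecs_def
  by (intro countable_Int2 countable_PiE finite_lattice_pts countable_rat)

text \<open>
  Rounding a vector down to multiples of \<open>1 / N\<close> is a monotone operation, so it stays in the cone;
  letting \<open>N\<close> grow shows that rational vectors come arbitrarily close to the maximal gain.
\<close>
lemma lse_loss_eq_SUP_rational:
  "lse_loss d n1 a \<epsilon> = (SUP k\<in>rational_monotone_vecs d n1. gain (lattice_pts d n1) \<epsilon> k)"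
proof -
  let ?I = "lattice_pts d n1" and ?D = "rational_monotone_vecs d n1"
  obtain k where k: "k \<in> monotone_vecs d n1" and eq: "lse_loss d n1 a \<epsilon> = gain ?I \<epsilon> k"
    using lse_loss_maximal_gain(2) by blast
  define r where "r N = (\<lambda>w\<in>?I. of_int \<lfloor>real (Suc N) * k w\<rfloor> / real (Suc N))" for N
  have r: "r N \<in> ?D" for N
  proof -
    have "r N \<in> monotone_vecs d n1"
      unfolding r_def
      by (rule restrict_in_monotone_vecs)
         (use monotone_vecs_le[OF k] in \<open>auto intro!: divide_right_mono floor_mono mult_left_mono\<close>)
    then show ?thesis by (auto simp: rational_monotone_vecs_def r_def)
  qed
  have lim: "(\<lambda>N. r N w) \<longlonglongrightarrow> k w" if "w \<in> ?I" for w
  proof (rule real_tendsto_sandwich)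
    show "\<forall>\<^sub>F N in sequentially. k w - 1 / real (Suc N) \<le> r N w"
    proof (rule always_eventually, rule allI)
      fix N
      have "real (Suc N) * k w - 1 \<le> of_int \<lfloor>real (Suc N) * k w\<rfloor>" by linarith
      then have "(real (Suc N) * k w - 1) / real (Suc N) \<le> r N w"
        using that unfolding r_def by (simp only: restrict_apply' divide_right_mono of_nat_0_le_iff)
      then show "k w - 1 / real (Suc N) \<le> r N w"
        by (simp add: diff_divide_distrib)
    qed
    show "\<forall>\<^sub>F N in sequentially. r N w \<le> k w"
    proof (rule always_eventually, rule allI)
      fix N
      have "of_int \<lfloor>real (Suc N) * k w\<rfloor> \<le> real (Suc N) * k w" by linarith
      then show "r N w \<le> k w"
        using that by (simp add: r_def field_simps)
    qed
    show "(\<lambda>N. k w - 1 / real (Suc N)) \<longlonglongrightarrow> k w"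
      using tendsto_diff[OF tendsto_const[of "k w"] LIMSEQ_inverse_real_of_nat]
      by (simp add: inverse_eq_divide)
  qed simp
  have bdd: "bdd_above (gain ?I \<epsilon> ` ?D)"
    using gain_le by (intro bdd_aboveI2)
  have "(\<lambda>N. gain ?I \<epsilon> (r N)) \<longlonglongrightarrow> gain ?I \<epsilon> k"
    unfolding gain_def by (intro tendsto_intros lim)
  then have "gain ?I \<epsilon> k \<le> (SUP k\<in>?D. gain ?I \<epsilon> k)"
    by (rule LIMSEQ_le_const2) (use r bdd in \<open>auto intro!: exI[of _ 0] cSUP_upper\<close>)
  moreover have "(SUP k\<in>?D. gain ?I \<epsilon> k) \<le> lse_loss d n1 a \<epsilon>"
    using r[of 0] by (intro cSUP_least lse_loss_maximal_gain(1)) (blast, simp add: rational_monotone_vecs_def)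
  ultimately show ?thesis using eq by linarith
qed

section \<open>Block sums of Gaussian noise\<close>

abbreviation std_normal :: "real measure" where
  "std_normal \<equiv> density lborel std_normal_density"

lemma prob_space_noise: "prob_space (PiM I (\<lambda>_. std_normal))"
  by (intro prob_space_PiM prob_space_normal_density) simp

lemma distributed_noise_coordinate:
  assumes "i \<in> I"
  shows "distributed (PiM I (\<lambda>_. std_normal)) lborel (\<lambda>x. x i) std_normal_density"
proof -
  have "distr (PiM I (\<lambda>_. std_normal)) lborel (\<lambda>x. x i)
      = distr (PiM I (\<lambda>_. std_normal)) std_normal (\<lambda>x. x i)"
    by (intro distr_cong) auto
  also have "\<dots> = std_normal"
    by (rule distr_PiM_component[OF prob_space_normal_density assms]) simp
  finally show ?thesis
    unfolding distributed_def using assms by auto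
qed

text \<open>
  Independence amounts to the joint law of the coordinates being the product of their laws, and here
  the joint law is that of the identity map on a product measure.
\<close>
lemma indep_noise_coordinates:
  assumes "I \<noteq> {}"
  shows "prob_space.indep_vars (PiM I (\<lambda>_. std_normal)) (\<lambda>_. borel) (\<lambda>i x. x i) I"
proof -
  interpret prob_space "PiM I (\<lambda>_. std_normal)" by (rule prob_space_noise)
  have "distr (PiM I (\<lambda>_. std_normal)) (PiM I (\<lambda>_. std_normal)) (\<lambda>x. \<lambda>i\<in>I. x i)
      = distr (PiM I (\<lambda>_. std_normal)) (PiM I (\<lambda>_. std_normal)) (\<lambda>x. x)"
    by (intro distr_cong) (auto simp: space_PiM)
  moreover have "PiM I (\<lambda>i. distr (PiM I (\<lambda>_. std_normal)) std_normal (\<lambda>x. x i)) = PiM I (\<lambda>_. std_normal)"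
    by (intro PiM_cong refl distr_PiM_component prob_space_normal_density) simp_all
  ultimately have "indep_vars (\<lambda>_. std_normal) (\<lambda>i x. x i) I"
    using assms by (subst indep_vars_iff_distr_eq_PiM') auto
  then show ?thesis
    by (simp add: indep_vars_def cong: measurable_cong_sets)
qed

lemma distributed_block_sum:
  assumes "B \<subseteq> I" "finite B" "B \<noteq> {}"
  shows "distributed (PiM I (\<lambda>_. std_normal)) lborel (\<lambda>x. \<Sum>w\<in>B. x w)
    (normal_density 0 (sqrt (card B)))"
proof -
  interpret prob_space "PiM I (\<lambda>_. std_normal)" by (rule prob_space_noise)
  have "indep_vars (\<lambda>_. borel) (\<lambda>i x. x i) B"
    using indep_noise_coordinates[of I] assms by (auto intro: indep_vars_subset)
  from sum_indep_normal[OF assms(2,3) this, of "\<lambda>_. 1" "\<lambda>_. 0"]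
  show ?thesis using assms(1) distributed_noise_coordinate[of _ I] by (auto simp: subset_iff)
qed

text \<open>
  The positive part is \<open>(|S| + S) / 2\<close>, so its mean is half the first absolute moment of a centred
  normal variable.
\<close>
lemma expectation_block_sum_positive_part:
  assumes "B \<subseteq> I" "finite B"
  shows "has_bochner_integral (PiM I (\<lambda>_. std_normal)) (\<lambda>x. max 0 (\<Sum>w\<in>B. x w))
    (sqrt (card B) / sqrt (2 * pi))"
proof (cases "B = {}")
  case False
  define \<sigma> where "\<sigma> = sqrt (card B)"
  have \<sigma>: "\<sigma> > 0" using False assms by (simp add: \<sigma>_def card_gt_0_iff)
  have D: "distributed (PiM I (\<lambda>_. std_normal)) lborel (\<lambda>x. \<Sum>w\<in>B. x w) (normal_density 0 \<sigma>)"
    unfolding \<sigma>_def by (rule distributed_block_sum[OF assms False])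
  have "has_bochner_integral lborel (\<lambda>x. normal_density 0 \<sigma> x * \<bar>x\<bar>) (\<sigma> * sqrt (2 / pi))"
    using normal_moment_abs_odd[OF \<sigma>, of 0 0] by (simp add: ac_simps)
  from has_bochner_integral_add[OF this normal_moment_nz_1[OF \<sigma>, of 0]]
  have "has_bochner_integral lborel (\<lambda>x. (normal_density 0 \<sigma> x * \<bar>x\<bar> + normal_density 0 \<sigma> x * x) / 2)
      ((\<sigma> * sqrt (2 / pi) + 0) / 2)"
    by (rule has_bochner_integral_divide_zero)
  moreover have "(\<sigma> * sqrt (2 / pi) + 0) / 2 = \<sigma> / sqrt (2 * pi)"
    by (simp add: real_sqrt_divide real_sqrt_mult field_simps)
  moreover have "(normal_density 0 \<sigma> x * \<bar>x\<bar> + normal_density 0 \<sigma> x * x) / 2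
      = normal_density 0 \<sigma> x * max 0 x" for x
    by (simp add: max_def)
  ultimately have *: "has_bochner_integral lborel (\<lambda>x. normal_density 0 \<sigma> x * max 0 x) (\<sigma> / sqrt (2 * pi))"
    by simp
  show ?thesis
    unfolding has_bochner_integral_iff \<sigma>_def[symmetric]
    using distributed_integrable[OF D, of "max 0"] distributed_integral[OF D, of "max 0"] *
    by (auto simp: has_bochner_integral_iff)
qed (auto simp: has_bochner_integral_zero)

lemma noise_coordinate_moments:
  assumes "i \<in> I"
  shows "has_bochner_integral (PiM I (\<lambda>_. std_normal)) (\<lambda>x. x i) 0"
    and "integrable (PiM I (\<lambda>_. std_normal)) (\<lambda>x. (x i)\<^sup>2)"
proof -
  note D = distributed_noise_coordinate[OF assms]
  show "has_bochner_integral (PiM I (\<lambda>_. std_normal)) (\<lambda>x. x i) 0"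
    unfolding has_bochner_integral_iff
    using distributed_integrable[OF D, of "\<lambda>x. x"] distributed_integral[OF D, of "\<lambda>x. x"]
      normal_moment_nz_1[of 1 0]
    by (auto simp: has_bochner_integral_iff)
  show "integrable (PiM I (\<lambda>_. std_normal)) (\<lambda>x. (x i)\<^sup>2)"
    using distributed_integrable[OF D, of "\<lambda>x. x\<^sup>2"] integrable_std_normal_moment[of 2] by auto
qed

section \<open>The risk at a constant truth\<close>

text \<open>A gain never exceeds \<open>\<parallel>\<epsilon>\<parallel>\<^sup>2\<close>, hence neither does the loss, and \<open>\<parallel>\<epsilon>\<parallel>\<^sup>2\<close> is integrable.\<close>
lemma lse_loss_integrable: "integrable (noise d n1) (lse_loss d n1 a)"
proof (rule Bochner_Integration.integrable_bound)
  let ?I = "lattice_pts d n1"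
  show "integrable (noise d n1) (\<lambda>\<epsilon>. \<Sum>w\<in>?I. (\<epsilon> w)\<^sup>2)"
    unfolding noise_def by (intro Bochner_Integration.integrable_sum noise_coordinate_moments)
  have "(\<lambda>\<epsilon>. SUP k\<in>rational_monotone_vecs d n1. gain ?I \<epsilon> k) \<in> borel_measurable (noise d n1)"
  proof (rule borel_measurable_cSUP)
    fix k
    show "(\<lambda>\<epsilon>. gain ?I \<epsilon> k) \<in> borel_measurable (noise d n1)"
      unfolding gain_def noise_def
      using noise_coordinate_moments(1)[THEN has_bochner_integral_iff[THEN iffD1]]
      by (auto intro!: borel_measurable_diff borel_measurable_times borel_measurable_sum
          dest: borel_measurable_integrable)
  qed (auto simp: countable_rational_monotone_vecs intro: bdd_aboveI2 gain_le)
  then show "lse_loss d n1 a \<in> borel_measurable (noise d n1)"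
    unfolding lse_loss_eq_SUP_rational[of d n1 a, symmetric] .
  show "AE \<epsilon> in noise d n1. norm (lse_loss d n1 a \<epsilon>) \<le> norm (\<Sum>w\<in>?I. (\<epsilon> w)\<^sup>2)"
  proof (rule AE_I2)
    fix \<epsilon>
    obtain k where "lse_loss d n1 a \<epsilon> = gain ?I \<epsilon> k" using lse_loss_maximal_gain(2) by blast
    moreover have "0 \<le> lse_loss d n1 a \<epsilon>" by (simp add: lse_loss_def sum_nonneg)
    ultimately show "norm (lse_loss d n1 a \<epsilon>) \<le> norm (\<Sum>w\<in>?I. (\<epsilon> w)\<^sup>2)"
      using gain_le[of ?I \<epsilon> k] by simp
  qed
qed

lemma risk_const_eq:
  assumes "\<theta>0 \<in> constant_vecs d n1"
  obtains a where "risk d n1 (lse d n1) \<theta>0 = (LINT \<epsilon>|noise d n1. lse_loss d n1 a \<epsilon>) / real (n1 ^ d)"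
proof -
  let ?I = "lattice_pts d n1"
  obtain a where a: "\<And>u. u \<in> ?I \<Longrightarrow> \<theta>0 u = a"
    using assms by (auto simp: constant_vecs_def)
  have obs: "observation d n1 \<theta>0 \<epsilon> = (\<lambda>w\<in>?I. a + \<epsilon> w)" for \<epsilon>
    unfolding observation_def by (rule restrict_ext) (simp add: a)
  have "(l2_dist ?I (lse d n1 (observation d n1 \<theta>0 \<epsilon>)) \<theta>0)\<^sup>2 = lse_loss d n1 a \<epsilon>" for \<epsilon>
    unfolding l2_dist_power2 obs lse_loss_def by (intro sum.cong) (auto simp: a)
  then have "risk d n1 (lse d n1) \<theta>0 = (LINT \<epsilon>|noise d n1. lse_loss d n1 a \<epsilon>) / real (n1 ^ d)"
    unfolding risk_def by simp
  then show ?thesis by (rule that)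
qed

section \<open>Monotone vectors with free signs on blocks\<close>

text \<open>
  The set \<open>s\<close> lists the blocks raised by their height \<open>h\<close>. Raising exactly the blocks with positive
  noise sum turns each block's contribution \<open>h b \<cdot> S\<^sub>b\<close> to the inner product into its positive part,
  while the deterministic part \<open>base\<close> contributes nothing on average. With \<open>m\<close> for the resulting
  expected inner product, the scaling \<open>t = m / V\<close> maximises the expected gain \<open>2 t m - t\<^sup>2 V\<close>.
  Points whose label lies outside \<open>J\<close> keep their value under \<open>base\<close>.
\<close>
lemma expectation_lse_loss_ge_blocks:
  fixes blk :: "(nat \<Rightarrow> nat) \<Rightarrow> 'b" and h :: "'b \<Rightarrow> real" and base :: "(nat \<Rightarrow> nat) \<Rightarrow> real"
  defines "\<kappa> \<equiv> \<lambda>s w. base w + (if blk w \<in> s then h (blk w) else 0)"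
  assumes J: "finite J" and V: "V > 0" and h: "\<And>b. b \<in> J \<Longrightarrow> h b \<ge> 0"
    and mono: "\<And>s u v. s \<subseteq> J \<Longrightarrow> u \<in> lattice_pts d n1 \<Longrightarrow> v \<in> lattice_pts d n1 \<Longrightarrow>
      lattice_le d u v \<Longrightarrow> \<kappa> s u \<le> \<kappa> s v"
    and norm: "\<And>s. s \<subseteq> J \<Longrightarrow> (\<Sum>w\<in>lattice_pts d n1. (\<kappa> s w)\<^sup>2) \<le> V"
  shows "(\<Sum>b\<in>J. h b * sqrt (card {w \<in> lattice_pts d n1. blk w = b}))\<^sup>2 / (2 * pi * V)
    \<le> (LINT \<epsilon>|noise d n1. lse_loss d n1 a \<epsilon>)"
proof -
  let ?I = "lattice_pts d n1"
  define B where "B b = {w \<in> ?I. blk w = b}" for b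
  define m where "m = (\<Sum>b\<in>J. h b * sqrt (card (B b))) / sqrt (2 * pi)"
  define t where "t = m / V"
  have t: "t \<ge> 0" unfolding t_def m_def using h V by (auto intro!: divide_nonneg_pos divide_nonneg_nonneg sum_nonneg)
  define G where "G \<epsilon> = (\<Sum>w\<in>?I. base w * \<epsilon> w) + (\<Sum>b\<in>J. h b * max 0 (\<Sum>w\<in>B b. \<epsilon> w))"
    for \<epsilon> :: "(nat \<Rightarrow> nat) \<Rightarrow> real"
  have G_int: "has_bochner_integral (noise d n1) G m"
  proof -
    have "has_bochner_integral (noise d n1) G
        ((\<Sum>w\<in>?I. base w * 0) + (\<Sum>b\<in>J. h b * (sqrt (card (B b)) / sqrt (2 * pi))))"
      unfolding G_def noise_def
      by (intro has_bochner_integral_add has_bochner_integral_sum has_bochner_integral_mult_right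
          noise_coordinate_moments(1) expectation_block_sum_positive_part)
         (auto simp: B_def finite_lattice_pts)
    then show ?thesis by (simp add: m_def sum_divide_distrib)
  qed
  have le: "2 * t * G \<epsilon> - t\<^sup>2 * V \<le> lse_loss d n1 a \<epsilon>" for \<epsilon>
  proof -
    define s where "s = {b \<in> J. (\<Sum>w\<in>B b. \<epsilon> w) > 0}"
    have s: "s \<subseteq> J" by (auto simp: s_def)
    have "(\<Sum>w\<in>?I. if blk w \<in> s then \<epsilon> w * h (blk w) else 0)
        = (\<Sum>w | w \<in> ?I \<and> blk w \<in> s. \<epsilon> w * h (blk w))"
      by (simp add: sum.inter_filter finite_lattice_pts)
    also have "\<dots> = (\<Sum>b\<in>s. \<Sum>w | w \<in> {w \<in> ?I. blk w \<in> s} \<and> blk w = b. \<epsilon> w * h (blk w))"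
      using finite_subset[OF s J] by (subst sum.group) (auto simp: finite_lattice_pts)
    also have "\<dots> = (\<Sum>b\<in>s. h b * (\<Sum>w\<in>B b. \<epsilon> w))"
      unfolding sum_distrib_left
      by (intro sum.cong) (auto simp: B_def)
    also have "\<dots> = (\<Sum>b\<in>J. h b * max 0 (\<Sum>w\<in>B b. \<epsilon> w))"
      by (rule sum.mono_neutral_cong_left) (use J in \<open>auto simp: s_def max_def\<close>)
    finally have "(\<Sum>w\<in>?I. \<epsilon> w * \<kappa> s w) = G \<epsilon>"
      unfolding G_def \<kappa>_def
      by (simp only: distrib_left sum.distrib if_distrib[of "(*) _"] mult_zero_right)
         (simp add: mult.commute)
    then have "2 * t * G \<epsilon> - t\<^sup>2 * (\<Sum>w\<in>?I. (\<kappa> s w)\<^sup>2) = gain ?I \<epsilon> (\<lambda>w. t * \<kappa> s w)"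
      unfolding gain_scale by simp
    also have "\<dots> = gain ?I \<epsilon> (\<lambda>w\<in>?I. t * \<kappa> s w)"
      by (rule gain_cong) simp
    also have "\<dots> \<le> lse_loss d n1 a \<epsilon>"
      by (intro lse_loss_maximal_gain(1) restrict_in_monotone_vecs mult_left_mono mono s t)
    finally show ?thesis
      using mult_left_mono[OF norm[OF s], of "t\<^sup>2"] by simp
  qed
  interpret prob_space "noise d n1" unfolding noise_def by (rule prob_space_noise)
  have G: "integrable (noise d n1) G" "integral\<^sup>L (noise d n1) G = m"
    using G_int by (auto simp: has_bochner_integral_iff)
  have "(LINT \<epsilon>|noise d n1. 2 * t * G \<epsilon> - t\<^sup>2 * V) \<le> (LINT \<epsilon>|noise d n1. lse_loss d n1 a \<epsilon>)"
    by (intro integral_mono lse_loss_integrable le) (use G in auto)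
  also have "(LINT \<epsilon>|noise d n1. 2 * t * G \<epsilon> - t\<^sup>2 * V) = 2 * t * m - t\<^sup>2 * V"
    using G by (simp add: prob_space)
  also have "\<dots> = m\<^sup>2 / V"
    using V by (simp add: t_def power2_eq_square field_simps)
  also have "\<dots> = (\<Sum>b\<in>J. h b * sqrt (card (B b)))\<^sup>2 / (2 * pi * V)"
    by (simp add: m_def power_divide)
  finally show ?thesis unfolding B_def .
qed

section \<open>Signs on an antichain\<close>

lemma lattice_le_sum_eq_imp_eq:
  assumes "u \<in> lattice_pts d n1" "v \<in> lattice_pts d n1" "lattice_le d u v"
    and "(\<Sum>j=1..d. v j) \<le> (\<Sum>j=1..d. u j)"
  shows "u = v"
proof (rule PiE_ext[of _ "{1..d}" "\<lambda>_. {1..n1}"])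
  fix j assume j: "j \<in> {1..d}"
  have le: "\<And>i. i \<in> {1..d} \<Longrightarrow> u i \<le> v i" using assms(3) by (auto simp: lattice_le_def)
  show "u j = v j"
  proof (rule ccontr)
    assume "u j \<noteq> v j"
    then have "(\<Sum>j=1..d. u j) < (\<Sum>j=1..d. v j)"
      using j le by (intro sum_strict_mono_ex1 bexI[of _ j]) (auto simp: order.not_eq_order_implies_strict)
    then show False using assms(4) by simp
  qed
qed (use assms in \<open>auto simp: lattice_pts_def\<close>)

text \<open>Pigeonhole: the coordinate sums of the \<open>n\<^sub>1\<^sup>d\<close> points all lie among \<open>d n\<^sub>1\<close> values.\<close>
lemma exists_large_level:
  assumes "d \<ge> 1" "n1 \<ge> 1"
  obtains m where "n1 ^ d \<le> d * n1 * card {u \<in> lattice_pts d n1. (\<Sum>j=1..d. u j) = m}"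
proof -
  let ?I = "lattice_pts d n1"
  let ?A = "\<lambda>m. {u \<in> ?I. (\<Sum>j=1..d. u j) = m}"
  have range: "(\<lambda>u. \<Sum>j=1..d. u j) ` ?I \<subseteq> {1..d * n1}"
  proof safe
    fix u assume "u \<in> ?I"
    then have u: "\<And>j. j \<in> {1..d} \<Longrightarrow> 1 \<le> u j \<and> u j \<le> n1"
      by (auto simp: lattice_pts_def PiE_iff)
    have "d \<le> (\<Sum>j=1..d. u j)" using sum_mono[of "{1..d}" "\<lambda>_. 1" u] u by simp
    moreover have "(\<Sum>j=1..d. u j) \<le> d * n1" using sum_mono[of "{1..d}" u "\<lambda>_. n1"] u by simp
    ultimately show "(\<Sum>j=1..d. u j) \<in> {1..d * n1}" using assms by auto
  qed
  have "\<exists>m. n1 ^ d \<le> d * n1 * card (?A m)"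
  proof (rule ccontr)
    assume "\<not> ?thesis"
    then have small: "d * n1 * card (?A m) < n1 ^ d" for m by (auto simp: not_le)
    have "n1 ^ d = (\<Sum>m\<in>{1..d * n1}. card (?A m))"
      using sum.group[OF finite_lattice_pts _ range, of "\<lambda>_. 1::nat"]
      by (simp add: card_lattice_pts)
    then have "d * n1 * n1 ^ d = (\<Sum>m\<in>{1..d * n1}. d * n1 * card (?A m))"
      by (simp add: sum_distrib_left)
    also have "\<dots> < (\<Sum>m\<in>{1..d * n1}. n1 ^ d)"
      using assms small by (intro sum_strict_mono) auto
    also have "\<dots> = d * n1 * n1 ^ d" by simp
    finally show False by simp
  qed
  then show ?thesis using that by blast
qed

text \<open>
  The blocks are the single points of a largest level of the coordinate sum. Distinct points of a
  level are incomparable, so any choice of signs on it, with \<open>-1\<close> below and \<open>1\<close> above, is monotone;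
  all these vectors have entries of modulus \<open>1\<close>, so \<open>V\<close> is the number of lattice points.
\<close>
lemma expectation_lse_loss_ge_antichain:
  assumes "d \<ge> 1" "n1 \<ge> 1"
  shows "2 / pi * (real n1 ^ d / (real d * real n1)\<^sup>2) \<le> (LINT \<epsilon>|noise d n1. lse_loss d n1 a \<epsilon>)"
proof -
  let ?I = "lattice_pts d n1"
  let ?\<Sigma> = "\<lambda>u::nat \<Rightarrow> nat. \<Sum>j=1..d. u j"
  obtain m where m: "n1 ^ d \<le> d * n1 * card {u \<in> ?I. ?\<Sigma> u = m}"
    using exists_large_level[OF assms] .
  define A where "A = {u \<in> ?I. ?\<Sigma> u = m}"
  define N where "N = real n1 ^ d"
  define base where "base u = (if ?\<Sigma> u \<le> m then -1 else 1 :: real)" for u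
  have A: "finite A" by (simp add: A_def finite_lattice_pts)
  have N: "N > 0" using assms by (simp add: N_def)
  have "(\<Sum>b\<in>A. 2 * sqrt (card {w \<in> ?I. w = b}))\<^sup>2 / (2 * pi * N)
      \<le> (LINT \<epsilon>|noise d n1. lse_loss d n1 a \<epsilon>)"
  proof (rule expectation_lse_loss_ge_blocks[where blk = "\<lambda>w. w" and base = base])
    fix s u v assume s: "s \<subseteq> A" and uv: "u \<in> ?I" "v \<in> ?I" "lattice_le d u v"
    have sums: "?\<Sigma> u \<le> ?\<Sigma> v" using uv(3) by (intro sum_mono) (auto simp: lattice_le_def)
    have inA: "\<And>w. w \<in> s \<Longrightarrow> ?\<Sigma> w = m" using s by (auto simp: A_def)
    show "base u + (if u \<in> s then 2 else 0) \<le> base v + (if v \<in> s then 2 else 0)"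
    proof (cases "?\<Sigma> v \<le> ?\<Sigma> u")
      case True
      then show ?thesis using lattice_le_sum_eq_imp_eq[OF uv] by simp
    next
      case False
      then show ?thesis using inA[of u] inA[of v] sums by (auto simp: base_def)
    qed
  next
    fix s assume "s \<subseteq> A"
    then have "(base w + (if w \<in> s then 2 else 0))\<^sup>2 = 1" for w
      by (auto simp: base_def A_def)
    then show "(\<Sum>w\<in>?I. (base w + (if w \<in> s then 2 else 0))\<^sup>2) \<le> N"
      by (simp add: card_lattice_pts N_def)
  qed (use A N in auto)
  moreover have "(\<Sum>b\<in>A. 2 * sqrt (card {w \<in> ?I. w = b})) = 2 * real (card A)"
  proof -
    have "{w \<in> ?I. w = b} = {b}" if "b \<in> A" for b using that by (auto simp: A_def)
    then have "(\<Sum>b\<in>A. 2 * sqrt (card {w \<in> ?I. w = b})) = (\<Sum>b\<in>A. 2)"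
      by (intro sum.cong) auto
    then show ?thesis by simp
  qed
  moreover have "2 / pi * (N / (real d * real n1)\<^sup>2) \<le> (2 * real (card A))\<^sup>2 / (2 * pi * N)"
  proof -
    have "N \<le> real d * real n1 * real (card A)"
      using m unfolding N_def A_def by (metis of_nat_le_iff of_nat_mult of_nat_power)
    then have "N\<^sup>2 \<le> (real d * real n1 * real (card A))\<^sup>2"
      using N by (intro power_mono) auto
    then have "N / (real d * real n1)\<^sup>2 \<le> (real (card A))\<^sup>2 / N"
      using N assms by (simp add: field_simps power2_eq_square)
    then have "2 / pi * (N / (real d * real n1)\<^sup>2) \<le> 2 / pi * ((real (card A))\<^sup>2 / N)"
      by (intro mult_left_mono) auto
    also have "\<dots> = (2 * real (card A))\<^sup>2 / (2 * pi * N)"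
      by (simp add: power_mult_distrib)
    finally show ?thesis .
  qed
  ultimately show ?thesis by (simp add: N_def)
qed

section \<open>Signs on geometric blocks of the plane\<close>

text \<open>
  The classes of equal level are \<open>{1}\<close> and the intervals from \<open>4\<^sup>i + 1\<close> to \<open>4\<^sup>i\<^sup>+\<^sup>1\<close>. Cutting just
  above the powers of \<open>4\<close> makes class \<open>i\<close> complete as soon as \<open>4\<^sup>i \<le> n\<^sub>1\<close>; in particular class \<open>0\<close> is
  always complete, so that even the smallest lattices contain a full block.
\<close>
definition level :: "nat \<Rightarrow> nat" where
  "level x = (LEAST i. x \<le> 4 ^ i)"

lemma level_le_iff: "level x \<le> i \<longleftrightarrow> x \<le> 4 ^ i"
proof
  have "x < 2 ^ x" by (rule less_exp)
  also have "(2::nat) ^ x \<le> 4 ^ x" by (rule power_mono) auto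
  finally have "x \<le> 4 ^ level x" unfolding level_def by (rule LeastI[OF less_imp_le])
  moreover assume "level x \<le> i"
  then have "(4::nat) ^ level x \<le> 4 ^ i" by (intro power_increasing) auto
  ultimately show "x \<le> 4 ^ i" by linarith
next
  assume "x \<le> 4 ^ i"
  then show "level x \<le> i" unfolding level_def by (rule Least_le)
qed

lemma level_mono: "x \<le> y \<Longrightarrow> level x \<le> level y"
  using iffD1[OF level_le_iff order_refl, of y] by (intro iffD2[OF level_le_iff]) (rule le_trans)

lemma card_level:
  assumes "4 ^ i \<le> n1"
  shows "4 ^ i \<le> 2 * card {x \<in> {1..n1}. level x = i}" "card {x \<in> {1..n1}. level x = i} \<le> 4 ^ i"
proof -
  have "4 ^ i \<le> 2 * card {x \<in> {1..n1}. level x = i} \<and> card {x \<in> {1..n1}. level x = i} \<le> 4 ^ i"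
  proof (cases i)
    case 0
    have lev: "level x = i \<longleftrightarrow> x \<le> 1" for x
      using level_le_iff[of x 0] 0 by simp
    have "{x \<in> {1..n1}. x \<le> 1} = {1}"
      using assms 0 by auto
    then show ?thesis unfolding lev using 0 by simp
  next
    case (Suc r)
    have lev: "level x = i \<longleftrightarrow> 4 ^ r < x \<and> x \<le> 4 ^ i" for x
      unfolding level_le_iff[symmetric] not_le[symmetric] Suc by linarith
    have "1 \<le> x \<and> x \<le> n1" if "4 ^ r < x" "x \<le> 4 ^ i" for x
      using that assms by linarith
    then have "{x \<in> {1..n1}. 4 ^ r < x \<and> x \<le> 4 ^ i} = {4 ^ r<..4 ^ i}"
      by (auto simp del: power_Suc)
    then show ?thesis unfolding lev using Suc by simp
  qed
  then show "4 ^ i \<le> 2 * card {x \<in> {1..n1}. level x = i}" "card {x \<in> {1..n1}. level x = i} \<le> 4 ^ i"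
    by auto
qed

definition levels :: "(nat \<Rightarrow> nat) \<Rightarrow> nat \<times> nat" where
  "levels w = (level (w 1), level (w 2))"

lemma card_levels:
  "card {w \<in> lattice_pts 2 n1. levels w = (i, j)}
    = card {x \<in> {1..n1}. level x = i} * card {x \<in> {1..n1}. level x = j}"
proof -
  have 12: "{1..2::nat} = {1, 2}" by auto
  have "{w \<in> lattice_pts 2 n1. levels w = (i, j)}
      = (\<Pi>\<^sub>E k\<in>{1..2}. {x \<in> {1..n1}. level x = (if k = 1 then i else j)})"
    unfolding lattice_pts_def levels_def 12
    by (rule set_eqI) (simp add: PiE_iff conj_ac)
  then show ?thesis
    by (simp add: card_PiE numeral_2_eq_2)
qed

text \<open>
  With heights \<open>h = 2\<^sup>-\<^sup>(\<^sup>i\<^sup>+\<^sup>j\<^sup>)\<close> on blocks of about \<open>4\<^sup>i\<^sup>+\<^sup>j\<close> points, both \<open>h \<surd>|b|\<close> and \<open>h\<^sup>2 |b|\<close> are of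
  constant order for each of the \<open>(L + 1)\<^sup>2\<close> blocks, so the bound is of the order of their number.
  Moving up by at least one index at least halves \<open>h\<close>, so the smaller value \<open>-2h\<close> of the higher block
  is at least the larger value of the lower block; where an index exceeds \<open>L\<close> the vectors are
  zero, which is above all of these values.
\<close>
lemma expectation_lse_loss_ge_planar:
  assumes L: "4 ^ L \<le> n1"
  shows "(real (Suc L))\<^sup>2 / (32 * pi) \<le> (LINT \<epsilon>|noise 2 n1. lse_loss 2 n1 a \<epsilon>)"
proof -
  let ?I = "lattice_pts 2 n1"
  define J where "J = {..L} \<times> {..L}"
  define h where "h b = (1/2::real) ^ (fst b + snd b)" for b :: "nat \<times> nat"
  define base where "base w = (if levels w \<in> J then - 2 * h (levels w) else 0)" for w
  let ?\<kappa> = "\<lambda>s w. base w + (if levels w \<in> s then h (levels w) else 0)"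
  let ?B = "\<lambda>b. {w \<in> ?I. levels w = b}"
  have h: "h b > 0" for b by (simp add: h_def)
  have J: "finite J" "card J = (Suc L)\<^sup>2" by (auto simp: J_def power2_eq_square)
  have block: "1 / 2 \<le> h b * sqrt (card (?B b))" "(h b)\<^sup>2 * card (?B b) \<le> 1" if "b \<in> J" for b
  proof -
    obtain i j where b: "b = (i, j)" by force
    define p q where "p = card {x \<in> {1..n1}. level x = i}" and "q = card {x \<in> {1..n1}. level x = j}"
    have "(4::nat) ^ i \<le> 4 ^ L" "(4::nat) ^ j \<le> 4 ^ L"
      using that by (auto simp: J_def b intro!: power_increasing)
    then have i: "4 ^ i \<le> n1" and j: "4 ^ j \<le> n1" using L by (blast intro: le_trans)+
    have pq: "4 ^ i \<le> 2 * p" "4 ^ j \<le> 2 * q" "p \<le> 4 ^ i" "q \<le> 4 ^ j"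
      unfolding p_def q_def by (fact card_level[OF i] card_level[OF j])+
    have "4 ^ i * 4 ^ j \<le> (2 * p) * (2 * q)" "p * q \<le> 4 ^ i * 4 ^ j"
      by (rule mult_le_mono pq)+
    then have prod: "real (4 ^ i * 4 ^ j) \<le> real ((2 * p) * (2 * q))" "real (p * q) \<le> real (4 ^ i * 4 ^ j)"
      by (simp_all only: of_nat_le_iff)
    have h2: "(h b)\<^sup>2 = 1 / (4 ^ i * 4 ^ j)"
    proof -
      have "((2::real) ^ k)\<^sup>2 = 4 ^ k" for k
        using power_mult[of "2::real" k 2] power_mult[of "2::real" 2 k] by (simp add: mult.commute)
      then show ?thesis by (simp add: h_def b power_one_over power_add power_mult_distrib)
    qed
    have card: "card (?B b) = p * q"
      unfolding b card_levels p_def q_def by simp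
    have sq: "1 / 4 \<le> (h b)\<^sup>2 * card (?B b)" "(h b)\<^sup>2 * card (?B b) \<le> 1"
      unfolding h2 card using prod by (simp_all add: divide_simps)
    have "sqrt (1 / 4) \<le> sqrt ((h b)\<^sup>2 * card (?B b))"
      using sq(1) by (rule real_sqrt_le_mono)
    moreover have "sqrt ((h b)\<^sup>2 * card (?B b)) = h b * sqrt (card (?B b))"
      using h[of b] by (simp add: real_sqrt_mult)
    ultimately show "1 / 2 \<le> h b * sqrt (card (?B b))" by (simp add: real_sqrt_divide)
    show "(h b)\<^sup>2 * card (?B b) \<le> 1" by (rule sq(2))
  qed
  have "(\<Sum>b\<in>J. h b * sqrt (card (?B b)))\<^sup>2 / (2 * pi * (4 * real (card J)))
      \<le> (LINT \<epsilon>|noise 2 n1. lse_loss 2 n1 a \<epsilon>)"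
  proof (rule expectation_lse_loss_ge_blocks[where blk = levels and base = base])
    fix s u v assume s: "s \<subseteq> J" and uv: "u \<in> ?I" "v \<in> ?I" "lattice_le 2 u v"
    have lev: "fst (levels u) \<le> fst (levels v)" "snd (levels u) \<le> snd (levels v)"
      using uv(3) by (auto simp: levels_def lattice_le_def intro!: level_mono)
    show "?\<kappa> s u \<le> ?\<kappa> s v"
    proof (cases "levels u = levels v")
      case True
      then show ?thesis by (simp add: base_def)
    next
      case False
      have up: "?\<kappa> s u \<le> (if levels u \<in> J then - h (levels u) else 0)"
        using s h[of "levels u"] by (auto simp: base_def)
      have low: "(if levels v \<in> J then - 2 * h (levels v) else 0) \<le> ?\<kappa> s v"
        using h[of "levels v"] by (auto simp: base_def)
      show ?thesis
      proof (cases "levels v \<in> J")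
        case True
        then have "levels u \<in> J" using lev by (auto simp: J_def mem_Times_iff)
        have "fst (levels u) + snd (levels u) < fst (levels v) + snd (levels v)"
          using lev False by (auto simp: prod_eq_iff)
        then have "(1/2::real) ^ (fst (levels v) + snd (levels v))
            \<le> (1/2) ^ Suc (fst (levels u) + snd (levels u))"
          by (intro power_decreasing) auto
        then have "2 * h (levels v) \<le> h (levels u)" by (simp add: h_def)
        then show ?thesis using up low True \<open>levels u \<in> J\<close> by simp
      next
        case False
        then show ?thesis using up low h[of "levels u"] by (auto split: if_splits)
      qed
    qed
  next
    fix s assume s: "s \<subseteq> J"
    have "(\<Sum>w\<in>?I. (?\<kappa> s w)\<^sup>2) \<le> (\<Sum>w\<in>?I. if levels w \<in> J then 4 * (h (levels w))\<^sup>2 else 0)"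
    proof (rule sum_mono)
      fix w
      show "(?\<kappa> s w)\<^sup>2 \<le> (if levels w \<in> J then 4 * (h (levels w))\<^sup>2 else 0)"
        using s by (auto simp: base_def power2_eq_square)
    qed
    also have "\<dots> = (\<Sum>w | w \<in> ?I \<and> levels w \<in> J. 4 * (h (levels w))\<^sup>2)"
      by (simp add: sum.inter_filter finite_lattice_pts)
    also have "\<dots> = (\<Sum>b\<in>J. \<Sum>w | w \<in> {w \<in> ?I. levels w \<in> J} \<and> levels w = b. 4 * (h (levels w))\<^sup>2)"
      using J by (subst sum.group) (auto simp: finite_lattice_pts)
    also have "\<dots> = (\<Sum>b\<in>J. \<Sum>w\<in>?B b. 4 * (h b)\<^sup>2)"
      by (intro sum.cong) auto
    also have "\<dots> \<le> (\<Sum>b\<in>J. 4)"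
      by (rule sum_mono) (use block(2) in \<open>simp add: mult.commute\<close>)
    finally show "(\<Sum>w\<in>?I. (?\<kappa> s w)\<^sup>2) \<le> 4 * real (card J)" by simp
  qed (use J h in \<open>auto simp: less_imp_le\<close>)
  moreover have "(real (Suc L))\<^sup>2 / (32 * pi)
      \<le> (\<Sum>b\<in>J. h b * sqrt (card (?B b)))\<^sup>2 / (2 * pi * (4 * real (card J)))"
  proof -
    have "real (card J) / 2 = (\<Sum>b\<in>J. 1 / 2)" by simp
    also have "\<dots> \<le> (\<Sum>b\<in>J. h b * sqrt (card (?B b)))" by (intro sum_mono block(1))
    finally have "(real (card J) / 2)\<^sup>2 \<le> (\<Sum>b\<in>J. h b * sqrt (card (?B b)))\<^sup>2"
      by (rule power_mono) simp
    then have "(real (card J) / 2)\<^sup>2 / (2 * pi * (4 * real (card J)))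
        \<le> (\<Sum>b\<in>J. h b * sqrt (card (?B b)))\<^sup>2 / (2 * pi * (4 * real (card J)))"
      by (rule divide_right_mono) simp
    moreover have "(real (card J) / 2)\<^sup>2 / (2 * pi * (4 * real (card J))) = real (card J) / (32 * pi)"
      by (simp add: power2_eq_square)
    ultimately show ?thesis using J by simp
  qed
  ultimately show ?thesis by linarith
qed

theorem proposition2:
  fixes d :: nat
  assumes "d \<ge> 2"
  shows "\<exists>c::real. c > 0 \<and>
    (\<forall>n n1 :: nat. \<forall>\<theta>0. n \<ge> 2 \<longrightarrow> n = n1 ^ d \<longrightarrow> \<theta>0 \<in> constant_vecs d n1 \<longrightarrow>
      risk d n1 (lse d n1) \<theta>0 \<ge>
        c * (if d = 2 then (ln (real n))\<^sup>2 / real n else real n powr (- 2 / real d)))"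
proof (cases "d = 2")
  case True
  \<comment> \<open>Here \<open>ln n = 2 ln n\<^sub>1 \<le> (L + 1) 2 ln 4\<close>, where \<open>4\<^sup>L\<close> is the largest power of \<open>4\<close> up to \<open>n\<^sub>1\<close>.\<close>
  define c :: real where "c = 1 / (32 * pi * (2 * ln 4)\<^sup>2)"
  have "c > 0" by (simp add: c_def)
  moreover have "c * ((ln (real n))\<^sup>2 / real n) \<le> risk d n1 (lse d n1) \<theta>0"
    if n: "n \<ge> 2" "n = n1 ^ d" and \<theta>0: "\<theta>0 \<in> constant_vecs d n1" for n n1 \<theta>0
  proof -
    obtain a where risk: "risk d n1 (lse d n1) \<theta>0 = (LINT \<epsilon>|noise d n1. lse_loss d n1 a \<epsilon>) / real (n1 ^ d)"
      using risk_const_eq[OF \<theta>0] .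
    have n1: "n1 \<ge> 1" using n assms by (cases n1) (auto simp: power_0_left)
    obtain L where L: "4 ^ L \<le> n1" "n1 < 4 ^ (L + 1)"
      using ex_power_ivl1[of 4 n1] n1 by auto
    have "real n1 \<le> 4 ^ Suc L"
      using L(2) by (metis Suc_eq_plus1 less_imp_le of_nat_le_iff of_nat_numeral of_nat_power)
    then have "ln (real n1) \<le> ln (4 ^ Suc L)"
      using n1 by (subst ln_le_cancel_iff) auto
    also have "\<dots> = real (Suc L) * ln 4" by (rule ln_realpow)
    finally have "ln (real n) \<le> real (Suc L) * (2 * ln 4)"
      using n(2) True n1 by (simp add: ln_realpow)
    then have "(ln (real n))\<^sup>2 \<le> (real (Suc L) * (2 * ln 4))\<^sup>2"
      using n(1) by (intro power_mono) auto
    then have "c * (ln (real n))\<^sup>2 \<le> c * (real (Suc L) * (2 * ln 4))\<^sup>2"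
      using \<open>c > 0\<close> by (intro mult_left_mono) auto
    also have "\<dots> = (real (Suc L))\<^sup>2 / (32 * pi)"
      by (simp add: c_def power_mult_distrib)
    also have "\<dots> \<le> (LINT \<epsilon>|noise d n1. lse_loss d n1 a \<epsilon>)"
      unfolding True by (rule expectation_lse_loss_ge_planar[OF L(1)])
    finally show ?thesis
      unfolding risk n(2)[symmetric] using n(1) by (simp add: divide_right_mono)
  qed
  ultimately show ?thesis using True by (intro exI[of _ c]) simp
next
  case False
  define c where "c = 2 / (pi * (real d)\<^sup>2)"
  have "c > 0" using assms by (simp add: c_def)
  moreover have "c * real n powr (- 2 / real d) \<le> risk d n1 (lse d n1) \<theta>0"
    if n: "n \<ge> 2" "n = n1 ^ d" and \<theta>0: "\<theta>0 \<in> constant_vecs d n1" for n n1 \<theta>0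
  proof -
    obtain a where risk: "risk d n1 (lse d n1) \<theta>0 = (LINT \<epsilon>|noise d n1. lse_loss d n1 a \<epsilon>) / real (n1 ^ d)"
      using risk_const_eq[OF \<theta>0] .
    have n1: "n1 \<ge> 1" using n assms by (cases n1) (auto simp: power_0_left)
    have "real n powr (- 2 / real d) = (real n1 powr real d) powr (- 2 / real d)"
      using n(2) n1 by (simp add: powr_realpow)
    also have "\<dots> = real n1 powr (- 2)"
      using assms by (simp add: powr_powr)
    also have "\<dots> = 1 / (real n1)\<^sup>2"
      using n1 by (simp add: powr_minus_divide powr_realpow[of _ 2, simplified])
    finally have "c * real n powr (- 2 / real d) = 2 / pi * (real n1 ^ d / (real d * real n1)\<^sup>2) / real (n1 ^ d)"
      using n1 by (simp add: c_def power_mult_distrib)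
    also have "\<dots> \<le> risk d n1 (lse d n1) \<theta>0"
      unfolding risk using assms n1
      by (intro divide_right_mono expectation_lse_loss_ge_antichain) auto
    finally show ?thesis .
  qed
  ultimately show ?thesis using False by (intro exI[of _ c]) simp
qed

end
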